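(* Let $\mathbb{F}$ be a field and $d\ge 0$ an integer. Let $\Phi = (\{E_i\}_{i=0}^d; \{E^*_i\}_{i=0}^d)$ denote a symmetric idempotent system over $\mathbb{F}$ with diameter $d$, in an algebra $\mathcal{A}$. Let $\mathcal{M}$ be the commutative subalgebra of $\mathcal{A}$ with basis $\{E_i\}_{i=0}^d$, and for $0\le i\le d$ let $A_i$ be the unique element of $\mathcal{M}$ such that $A_iE^*_0E_0=E^*_iE_0$. Define $\Psi_\Phi = (\mathcal{M}; \{A_i\}_{i=0}^d; \{E_i\}_{i=0}^d)$. Then $\Psi_\Phi$ is a character system over $\mathbb{F}$ whose eigenmatrix is the first eigenmatrix of $\Phi$.
   Context: All algebras are associative, unital, over $\mathbb{F}$. For bases $\{u_i\}_{i=0}^d$, $\{v_i\}_{i=0}^d$ of a vector space, the transition matrix from $\{u_i\}$ to $\{v_i\}$ is the matrix $P$ with $v_j=\sum_{i=0}^d P_{i,j}u_i$. Idempotent systems. Let $\mathcal{A}$ be an algebra isomorphic to the matrix algebra $\mathrm{Mat}_{d+1}(\mathbb{F})$ (rank of an element means the rank of its image under such an isomorphism). A system of mutually orthogonal rank $1$ idempotents in $\mathcal{A}$ is a sequence $\{E_i\}_{i=0}^d$ with $E_iE_j = \delta_{i,j}E_i$ and $\mathrm{rank}(E_i)=1$ for $0\le i,j\le d$. An idempotent system in $\mathcal{A}$ (over $\mathbb{F}$, of diameter $d$) is a sequence $\Phi = (\{E_i\}_{i=0}^d; \{E^*_i\}_{i=0}^d)$ such that $\{E_i\}_{i=0}^d$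 and $\{E^*_i\}_{i=0}^d$ are systems of mutually orthogonal rank $1$ idempotents in $\mathcal{A}$, $E_0E^*_iE_0 \neq 0$ and $E^*_0E_iE^*_0\neq 0$ for $0\le i\le d$. $\Phi$ is symmetric if there is an antiautomorphism of $\mathcal{A}$ (an $\mathbb{F}$-linear bijection $\tau$ with $(YZ)^\tau = Z^\tau Y^\tau$) that fixes each $E_i$ and $E^*_i$. For symmetric $\Phi$, the elements $A_i$ exist uniquely and $\{A_i\}_{i=0}^d$ is a basis of $\mathcal{M}$; the first eigenmatrix of $\Phi$ is the transition matrix from $\{E_i\}_{i=0}^d$ to $\{A_i\}_{i=0}^d$. Character systems. A character algebra over $\mathbb{F}$ with diameter $d$ is a sequence $(\mathcal{C};\{x_i\}_{i=0}^d)$ where $\mathcal{C}$ is a commutative $\mathbb{F}$-algebra and $x_i\in\mathcal{C}$ satisfy: (i) $x_0=1$; (ii) $\{x_i\}_{i=0}^d$ is a basis of $\mathcal{C}$; (iii) writing $x_ix_j=\sum_{h=0}^d p^h_{ij}x_h$, there are nonzero scalars $\{k_i\}_{i=0}^d$ with $p^0_{ij}=\delta_{i,j}k_i$ for $0\le i,j\le d$; (iv) there is an algebra homomorphism $\varphi:\mathcal{C}\to\mathbb{F}$ with $\varphi(x_i)=k_i$ for $0\le i\le d$. It is semisimple if $\mathcal{C}$ has a basis $\{e_i\}_{i=0}^d$ with $e_ie_j=\delta_{i,j}e_i$ and $1=\sum_{i=0}^d e_i$; these $e_i$ (unique up to permutation) are the primitive idempotents. Exactly one primitive idempotent is not sent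 to $0$ by $\varphi$; it is called trivial. A character system over $\mathbb{F}$ with diameter $d$ is a sequence $\Psi=(\mathcal{C};\{x_i\}_{i=0}^d;\{e_i\}_{i=0}^d)$ where $(\mathcal{C};\{x_i\}_{i=0}^d)$ is a semisimple character algebra over $\mathbb{F}$ and $\{e_i\}_{i=0}^d$ is an ordering of the primitive idempotents of $\mathcal{C}$ with $e_0$ trivial. Its eigenmatrix is the transition matrix from $\{e_i\}_{i=0}^d$ to $\{x_i\}_{i=0}^d$. *)

theory Defs
  imports "Jordan_Normal_Form.DL_Rank"
begin

text \<open>
  An algebra over the field \<open>'f\<close> is the type \<open>'a::ring_1\<close> with a scalar multiplication \<open>scale\<close>.
  A commutative algebra \<open>C\<close>, which has to be instantiated by a subalgebra, is a subset of such a
  type (with \<open>C = UNIV\<close> allowed). A family indexed by \<open>0, ..., d\<close> is a function on \<open>nat\<close> whose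
  values beyond \<open>d\<close> are never used. The names qualified by \<open>Modules\<close> and \<open>Vector_Spaces\<close> refer to
  the vector spaces of HOL, as opposed to those of HOL-Algebra.
\<close>

locale unital_algebra = Vector_Spaces.vector_space scale
  for scale :: "'f::field \<Rightarrow> 'a::ring_1 \<Rightarrow> 'a" +
  assumes scale_mult_left: "scale c x * y = scale c (x * y)"
    and scale_mult_right: "x * scale c y = scale c (x * y)"

definition basis_family ::
  "('f::field \<Rightarrow> 'a::ab_group_add \<Rightarrow> 'a) \<Rightarrow> nat \<Rightarrow> 'a set \<Rightarrow> (nat \<Rightarrow> 'a) \<Rightarrow> bool" where
  "basis_family scale d V u \<longleftrightarrow>
     inj_on u {0..d} \<and> \<not> Modules.module.dependent scale (u ` {0..d}) \<and>
     Modules.module.span scale (u ` {0..d}) = V"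

text \<open>The description is only meaningful if \<open>u\<close> and \<open>v\<close> are bases of the same space.\<close>

definition transition_matrix ::
  "('f::field \<Rightarrow> 'a::ab_group_add \<Rightarrow> 'a) \<Rightarrow> nat \<Rightarrow> (nat \<Rightarrow> 'a) \<Rightarrow> (nat \<Rightarrow> 'a) \<Rightarrow> 'f mat" where
  "transition_matrix scale d u v =
     (THE P. P \<in> carrier_mat (d + 1) (d + 1) \<and>
        (\<forall>j\<le>d. v j = (\<Sum>i=0..d. scale (P $$ (i, j)) (u i))))"

subsection \<open>Idempotent systems\<close>

definition matrix_algebra_iso ::
  "('f::field \<Rightarrow> 'a::ring_1 \<Rightarrow> 'a) \<Rightarrow> nat \<Rightarrow> ('a \<Rightarrow> 'f mat) \<Rightarrow> bool" where
  "matrix_algebra_iso scale n \<phi> \<longleftrightarrow>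
     bij_betw \<phi> UNIV (carrier_mat n n) \<and>
     (\<forall>x y. \<phi> (x + y) = \<phi> x + \<phi> y) \<and>
     (\<forall>c x. \<phi> (scale c x) = c \<cdot>\<^sub>m \<phi> x) \<and>
     (\<forall>x y. \<phi> (x * y) = \<phi> x * \<phi> y) \<and>
     \<phi> 1 = 1\<^sub>m n"

definition isomorphic_to_matrix_algebra ::
  "('f::field \<Rightarrow> 'a::ring_1 \<Rightarrow> 'a) \<Rightarrow> nat \<Rightarrow> bool" where
  "isomorphic_to_matrix_algebra scale n \<longleftrightarrow>
     unital_algebra scale \<and> (\<exists>\<phi>. matrix_algebra_iso scale n \<phi>)"

text \<open>
  The choice of the isomorphism is immaterial: by Skolem-Noether any two differ by a conjugation
  of the matrix algebra.
\<close>

definition algebra_rank ::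
  "('f::field \<Rightarrow> 'a::ring_1 \<Rightarrow> 'a) \<Rightarrow> nat \<Rightarrow> 'a \<Rightarrow> nat" where
  "algebra_rank scale n x = vec_space.rank n ((SOME \<phi>. matrix_algebra_iso scale n \<phi>) x)"

definition orthogonal_rank1_idempotents ::
  "('f::field \<Rightarrow> 'a::ring_1 \<Rightarrow> 'a) \<Rightarrow> nat \<Rightarrow> (nat \<Rightarrow> 'a) \<Rightarrow> bool" where
  "orthogonal_rank1_idempotents scale d E \<longleftrightarrow>
     (\<forall>i\<le>d. \<forall>j\<le>d. E i * E j = (if i = j then E i else 0)) \<and>
     (\<forall>i\<le>d. algebra_rank scale (d + 1) (E i) = 1)"

text \<open>A pair \<open>(E, Es)\<close> stands for the pair of sequences \<open>E\<^sub>i\<close>, \<open>E\<^sup>*\<^sub>i\<close>.\<close>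

type_synonym 'a idem_pair = "(nat \<Rightarrow> 'a) \<times> (nat \<Rightarrow> 'a)"

fun idempotent_system ::
  "('f::field \<Rightarrow> 'a::ring_1 \<Rightarrow> 'a) \<Rightarrow> nat \<Rightarrow> 'a idem_pair \<Rightarrow> bool" where
  "idempotent_system scale d (E, Es) \<longleftrightarrow>
     isomorphic_to_matrix_algebra scale (d + 1) \<and>
     orthogonal_rank1_idempotents scale d E \<and>
     orthogonal_rank1_idempotents scale d Es \<and>
     (\<forall>i\<le>d. E 0 * Es i * E 0 \<noteq> 0) \<and>
     (\<forall>i\<le>d. Es 0 * E i * Es 0 \<noteq> 0)"

definition antiautomorphism ::
  "('f::field \<Rightarrow> 'a::ring_1 \<Rightarrow> 'a) \<Rightarrow> ('a \<Rightarrow> 'a) \<Rightarrow> bool" where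
  "antiautomorphism scale \<tau> \<longleftrightarrow>
     Vector_Spaces.linear scale scale \<tau> \<and> bij \<tau> \<and> (\<forall>y z. \<tau> (y * z) = \<tau> z * \<tau> y)"

fun symmetric_idempotent_system ::
  "('f::field \<Rightarrow> 'a::ring_1 \<Rightarrow> 'a) \<Rightarrow> nat \<Rightarrow> 'a idem_pair \<Rightarrow> bool" where
  "symmetric_idempotent_system scale d (E, Es) \<longleftrightarrow>
     idempotent_system scale d (E, Es) \<and>
     (\<exists>\<tau>. antiautomorphism scale \<tau> \<and> (\<forall>i\<le>d. \<tau> (E i) = E i \<and> \<tau> (Es i) = Es i))"

fun system_M ::
  "('f::field \<Rightarrow> 'a::ring_1 \<Rightarrow> 'a) \<Rightarrow> nat \<Rightarrow> 'a idem_pair \<Rightarrow> 'a set" where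
  "system_M scale d (E, Es) = Modules.module.span scale (E ` {0..d})"

fun system_A ::
  "('f::field \<Rightarrow> 'a::ring_1 \<Rightarrow> 'a) \<Rightarrow> nat \<Rightarrow> 'a idem_pair \<Rightarrow> nat \<Rightarrow> 'a" where
  "system_A scale d (E, Es) i =
     (THE X. X \<in> system_M scale d (E, Es) \<and> X * Es 0 * E 0 = Es i * E 0)"

fun first_eigenmatrix ::
  "('f::field \<Rightarrow> 'a::ring_1 \<Rightarrow> 'a) \<Rightarrow> nat \<Rightarrow> 'a idem_pair \<Rightarrow> 'f mat" where
  "first_eigenmatrix scale d (E, Es) =
     transition_matrix scale d E (system_A scale d (E, Es))"

subsection \<open>Character systems\<close>

definition commutative_algebra_on ::
  "('f::field \<Rightarrow> 'a::ring_1 \<Rightarrow> 'a) \<Rightarrow> 'a set \<Rightarrow> bool" where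
  "commutative_algebra_on scale C \<longleftrightarrow>
     unital_algebra scale \<and> Modules.module.subspace scale C \<and> 1 \<in> C \<and>
     (\<forall>x\<in>C. \<forall>y\<in>C. x * y \<in> C \<and> x * y = y * x)"

definition algebra_hom_to_field ::
  "('f::field \<Rightarrow> 'a::ring_1 \<Rightarrow> 'a) \<Rightarrow> 'a set \<Rightarrow> ('a \<Rightarrow> 'f) \<Rightarrow> bool" where
  "algebra_hom_to_field scale C \<phi> \<longleftrightarrow>
     (\<forall>x\<in>C. \<forall>y\<in>C. \<phi> (x + y) = \<phi> x + \<phi> y \<and> \<phi> (x * y) = \<phi> x * \<phi> y) \<and>
     (\<forall>c. \<forall>x\<in>C. \<phi> (scale c x) = c * \<phi> x) \<and>
     \<phi> 1 = 1"

text \<open>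
  The homomorphism \<open>\<phi>\<close> is kept as an argument because the trivial idempotent refers to it. On \<open>C\<close>
  it is determined by the basis \<open>x\<close>: the structure constants \<open>p h i j\<close> (that is, \<open>p\<^sup>h\<^sub>i\<^sub>j\<close>) are,
  hence so are \<open>k i = p 0 i i\<close> and \<open>\<phi> (x i) = k i\<close>.
\<close>

definition character_algebra_with ::
  "('f::field \<Rightarrow> 'a::ring_1 \<Rightarrow> 'a) \<Rightarrow> nat \<Rightarrow> 'a set \<Rightarrow> (nat \<Rightarrow> 'a) \<Rightarrow> ('a \<Rightarrow> 'f) \<Rightarrow> bool" where
  "character_algebra_with scale d C x \<phi> \<longleftrightarrow>
     commutative_algebra_on scale C \<and>
     x 0 = 1 \<and>
     basis_family scale d C x \<and>
     (\<exists>p k.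
        (\<forall>i\<le>d. \<forall>j\<le>d. x i * x j = (\<Sum>h=0..d. scale (p h i j) (x h))) \<and>
        (\<forall>i\<le>d. k i \<noteq> 0) \<and>
        (\<forall>i\<le>d. \<forall>j\<le>d. p 0 i j = (if i = j then k i else 0)) \<and>
        algebra_hom_to_field scale C \<phi> \<and>
        (\<forall>i\<le>d. \<phi> (x i) = k i))"

definition character_algebra ::
  "('f::field \<Rightarrow> 'a::ring_1 \<Rightarrow> 'a) \<Rightarrow> nat \<Rightarrow> 'a set \<Rightarrow> (nat \<Rightarrow> 'a) \<Rightarrow> bool" where
  "character_algebra scale d C x \<longleftrightarrow> (\<exists>\<phi>. character_algebra_with scale d C x \<phi>)"

definition primitive_idempotents ::
  "('f::field \<Rightarrow> 'a::ring_1 \<Rightarrow> 'a) \<Rightarrow> nat \<Rightarrow> 'a set \<Rightarrow> (nat \<Rightarrow> 'a) \<Rightarrow> bool" where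
  "primitive_idempotents scale d C e \<longleftrightarrow>
     basis_family scale d C e \<and>
     (\<forall>i\<le>d. \<forall>j\<le>d. e i * e j = (if i = j then e i else 0)) \<and>
     1 = (\<Sum>i=0..d. e i)"

definition semisimple_character_algebra ::
  "('f::field \<Rightarrow> 'a::ring_1 \<Rightarrow> 'a) \<Rightarrow> nat \<Rightarrow> 'a set \<Rightarrow> (nat \<Rightarrow> 'a) \<Rightarrow> bool" where
  "semisimple_character_algebra scale d C x \<longleftrightarrow>
     character_algebra scale d C x \<and> (\<exists>e. primitive_idempotents scale d C e)"

definition trivial_idempotent ::
  "('f::field \<Rightarrow> 'a::ring_1 \<Rightarrow> 'a) \<Rightarrow> nat \<Rightarrow> 'a set \<Rightarrow> (nat \<Rightarrow> 'a) \<Rightarrow> 'a \<Rightarrow> bool" where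
  "trivial_idempotent scale d C x f \<longleftrightarrow>
     (\<exists>\<phi>. character_algebra_with scale d C x \<phi> \<and> \<phi> f \<noteq> 0)"

type_synonym 'a char_triple = "'a set \<times> (nat \<Rightarrow> 'a) \<times> (nat \<Rightarrow> 'a)"

fun character_system ::
  "('f::field \<Rightarrow> 'a::ring_1 \<Rightarrow> 'a) \<Rightarrow> nat \<Rightarrow> 'a char_triple \<Rightarrow> bool" where
  "character_system scale d (C, x, e) \<longleftrightarrow>
     semisimple_character_algebra scale d C x \<and>
     primitive_idempotents scale d C e \<and>
     trivial_idempotent scale d C x (e 0)"

fun eigenmatrix ::
  "('f::field \<Rightarrow> 'a::ring_1 \<Rightarrow> 'a) \<Rightarrow> nat \<Rightarrow> 'a char_triple \<Rightarrow> 'f mat" where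
  "eigenmatrix scale d (C, x, e) = transition_matrix scale d e x"

fun system_Psi ::
  "('f::field \<Rightarrow> 'a::ring_1 \<Rightarrow> 'a) \<Rightarrow> nat \<Rightarrow> 'a idem_pair \<Rightarrow> 'a char_triple" where
  "system_Psi scale d (E, Es) =
     (system_M scale d (E, Es), system_A scale d (E, Es), E)"

end

theory Submission
  imports Defs
begin

text \<open>
  Each corner \<open>E\<^sub>i \<A> E\<^sub>j\<close> or \<open>E\<^sup>*\<^sub>i \<A> E\<^sub>j\<close> is one-dimensional, so \<open>X \<mapsto> X E\<^sup>*\<^sub>0 E\<^sub>0\<close> is a bijection
  from \<open>M\<close> onto \<open>\<A> E\<^sub>0\<close>. It carries \<open>A\<^sub>i\<close> to \<open>E\<^sup>*\<^sub>i E\<^sub>0\<close>, and these elements form a basis of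
  \<open>\<A> E\<^sub>0\<close>; hence the \<open>A\<^sub>i\<close> form a basis of \<open>M\<close>. The antiautomorphism fixes \<open>M\<close> pointwise and
  turns the defining equation of \<open>A\<^sub>i\<close> into \<open>E\<^sub>0 E\<^sup>*\<^sub>0 A\<^sub>i = E\<^sub>0 E\<^sup>*\<^sub>i\<close>. Evaluating
  \<open>E\<^sub>0 E\<^sup>*\<^sub>0 A\<^sub>i A\<^sub>j E\<^sup>*\<^sub>0 E\<^sub>0\<close> in two ways then gives \<open>p\<^sup>0\<^sub>i\<^sub>j = \<delta>\<^sub>i\<^sub>j m\<^sub>i / m\<^sub>0\<close>, where
  \<open>E\<^sub>0 E\<^sup>*\<^sub>i E\<^sub>0 = m\<^sub>i E\<^sub>0\<close>. The homomorphism \<open>\<phi>\<close> reads off the coefficient of \<open>E\<^sub>0\<close>.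
\<close>

section \<open>Rank one matrices\<close>

text \<open>A maximal independent set of columns is a single nonzero \<open>w\<close>, so every
  column is a multiple of \<open>w\<close>; take \<open>u\<close> to be \<open>w\<close> and
  \<open>v\<close> the multipliers.\<close>

lemma (in vec_space) rank_one_outer_product:
  assumes A: "A \<in> carrier_mat n nc" and rank: "rank A = 1"
  obtains u v where "A = mat n nc (\<lambda>(i, j). u i * v j)"
    and "\<exists>i<n. u i \<noteq> 0" and "\<exists>j<nc. v j \<noteq> 0"
proof -
  let ?P = "\<lambda>T. T \<subseteq> set (cols A) \<and> lin_indpt T"
  have cols: "set (cols A) \<subseteq> carrier_vec n"
    using A cols_dim by blast
  obtain S where S: "maximal S ?P" "finite S"
    using maximal_exists_superset[of "set (cols A)" ?P "{}"] finite_lin_indpt2 by auto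
  then have "card S = 1"
    using rank_card_indpt[OF A] rank by simp
  then obtain w where "S = {w}"
    by (auto simp: card_1_singleton_iff)
  with S have w: "w \<in> set (cols A)" "lin_indpt {w}"
    by (auto simp: maximal_def)
  have wc: "w \<in> carrier_vec n"
    using w(1) cols by auto
  have w0: "w \<noteq> 0\<^sub>v n"
  proof -
    have "(UNIV :: 'a set) \<noteq> {0}"
      by (metis UNIV_I singletonD zero_neq_one)
    then show ?thesis
      using w(2) zero_nin_lin_indpt[of "{w}"] wc by auto
  qed
  have multiple: "\<exists>c. x = c \<cdot>\<^sub>v w" if x: "x \<in> set (cols A)" for x
  proof (cases "x = w")
    case True
    then show ?thesis
      by (intro exI[of _ 1]) auto
  next
    case False
    have xc: "x \<in> carrier_vec n"
      using x cols by auto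
    have "lin_dep {w, x}"
      using rank_ge_card_indpt[OF A, of "{w, x}"] False w(1) x rank by auto
    then have "x \<in> span {w}"
      using lin_dep_iff_in_span[of "{w}" x] w(2) wc xc False by (auto simp: insert_commute)
    then obtain a where "x = lincomb a {w}"
      using finite_span[of "{w}"] wc by auto
    moreover have "lincomb a {w} = a w \<cdot>\<^sub>v w"
      using wc lincomb_dim[of "{w}" a] by (intro eq_vecI) (auto simp: lincomb_index)
    ultimately show ?thesis
      by blast
  qed
  obtain v where v: "\<And>x. x \<in> set (cols A) \<Longrightarrow> x = v x \<cdot>\<^sub>v w"
    using multiple by metis
  have col: "col A j \<in> set (cols A)" if "j < nc" for j
    using that A by (auto simp: cols_def)
  have entry: "A $$ (i, j) = w $ i * v (col A j)" if "i < n" "j < nc" for i j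
  proof -
    have "A $$ (i, j) = col A j $ i"
      using that A by simp
    also have "\<dots> = (v (col A j) \<cdot>\<^sub>v w) $ i"
      using v[OF col[OF that(2)]] by simp
    finally show ?thesis
      using that wc by simp
  qed
  show thesis
  proof
    show "A = mat n nc (\<lambda>(i, j). w $ i * v (col A j))"
      using A entry by (intro eq_matI) auto
    show "\<exists>i<n. w $ i \<noteq> 0"
      using w0 wc by (metis carrier_vecD eq_vecI index_zero_vec)
    obtain j where j: "j < nc" "w = col A j"
      using w(1) A by (auto simp: cols_def)
    have "v w \<noteq> 0"
    proof
      assume "v w = 0"
      moreover have "0 \<cdot>\<^sub>v w = 0\<^sub>v n"
        using wc by (intro eq_vecI) auto
      ultimately show False
        using v[OF w(1)] w0 by metis
    qed
    then show "\<exists>j<nc. v (col A j) \<noteq> 0"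
      using j by auto
  qed
qed

text \<open>By associativity the inner factors collapse to the scalar v^T B w, which is the double
  sum.\<close>

lemma outer_product_sandwich:
  fixes u v w z :: "nat \<Rightarrow> 'f::comm_ring_1"
  assumes "B \<in> carrier_mat n n"
  shows "mat n n (\<lambda>(i, j). u i * v j) * B * mat n n (\<lambda>(i, j). w i * z j) =
    (\<Sum>k<n. \<Sum>l<n. v k * B $$ (k, l) * w l) \<cdot>\<^sub>m mat n n (\<lambda>(i, j). u i * z j)"
proof (intro eq_matI)
  fix i j
  assume "i < dim_row ((\<Sum>k<n. \<Sum>l<n. v k * B $$ (k, l) * w l) \<cdot>\<^sub>m mat n n (\<lambda>(i, j). u i * z j))"
    and "j < dim_col ((\<Sum>k<n. \<Sum>l<n. v k * B $$ (k, l) * w l) \<cdot>\<^sub>m mat n n (\<lambda>(i, j). u i * z j))"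
  then have ij: "i < n" "j < n"
    by auto
  have "(mat n n (\<lambda>(i, j). u i * v j) * B * mat n n (\<lambda>(i, j). w i * z j)) $$ (i, j) =
      (\<Sum>l<n. (\<Sum>k<n. u i * v k * B $$ (k, l)) * (w l * z j))"
    using ij assms by (simp add: scalar_prod_def atLeast0LessThan)
  also have "\<dots> = (\<Sum>l<n. \<Sum>k<n. (v k * B $$ (k, l) * w l) * (u i * z j))"
    by (simp add: sum_distrib_left sum_distrib_right mult_ac)
  also have "\<dots> = (\<Sum>k<n. \<Sum>l<n. v k * B $$ (k, l) * w l) * (u i * z j)"
    by (subst sum.swap) (simp add: sum_distrib_right)
  finally show "(mat n n (\<lambda>(i, j). u i * v j) * B * mat n n (\<lambda>(i, j). w i * z j)) $$ (i, j) =
      ((\<Sum>k<n. \<Sum>l<n. v k * B $$ (k, l) * w l) \<cdot>\<^sub>m mat n n (\<lambda>(i, j). u i * z j)) $$ (i, j)"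
    using ij by simp
qed (use assms in auto)

lemma rank_one_corner:
  fixes A B :: "'f::field mat"
  assumes A: "A \<in> carrier_mat n n" "vec_space.rank n A = 1" and B: "B \<in> carrier_mat n n"
  shows "\<exists>c. A * B * A = c \<cdot>\<^sub>m A"
proof -
  obtain u v where "A = mat n n (\<lambda>(i, j). u i * v j)"
    using vec_space.rank_one_outer_product[OF A] by metis
  then show ?thesis
    using outer_product_sandwich[OF B, of u v u v] by auto
qed

text \<open>
  If \<open>F i = u\<^sub>i v\<^sub>i\<^sup>T\<close>, orthogonality says that the matrix \<open>V\<close> with rows \<open>v\<^sub>i\<^sup>T\<close> is a left
  inverse of the matrix \<open>U\<close> with columns \<open>u\<^sub>i\<close>; the sum of the \<open>F i\<close> is \<open>U V\<close>.
\<close>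

lemma sum_orthogonal_rank_one_idempotents:
  fixes F :: "nat \<Rightarrow> 'f::field mat"
  assumes F: "\<And>i. i < n \<Longrightarrow> F i \<in> carrier_mat n n"
    and rank: "\<And>i. i < n \<Longrightarrow> vec_space.rank n (F i) = 1"
    and orth: "\<And>i j. i < n \<Longrightarrow> j < n \<Longrightarrow> F i * F j = (if i = j then F i else 0\<^sub>m n n)"
    and ab: "a < n" "b < n"
  shows "(\<Sum>i<n. F i $$ (a, b)) = 1\<^sub>m n $$ (a, b)"
proof -
  have "\<forall>i. \<exists>u v. i < n \<longrightarrow> F i = mat n n (\<lambda>(k, l). u k * v l) \<and>
      (\<exists>k<n. u k \<noteq> 0) \<and> (\<exists>l<n. v l \<noteq> 0)"
    using vec_space.rank_one_outer_product[OF F rank] by metis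
  then obtain u v where uv: "\<And>i. i < n \<Longrightarrow> F i = mat n n (\<lambda>(k, l). u i k * v i l)"
    and u0: "\<And>i. i < n \<Longrightarrow> \<exists>k<n. u i k \<noteq> 0" and v0: "\<And>i. i < n \<Longrightarrow> \<exists>l<n. v i l \<noteq> 0"
    by metis
  define U where "U = mat n n (\<lambda>(k, i). u i k)"
  define V where "V = mat n n (\<lambda>(i, k). v i k)"
  have dual: "(\<Sum>k<n. v i k * u j k) = (if i = j then 1 else 0)" if ij: "i < n" "j < n" for i j
  proof -
    \<comment> \<open>Nonzero entries of \<open>u i\<close> and \<open>v j\<close>: comparing this
      single entry of \<open>F i * F j\<close> lets their product be cancelled.\<close>
    obtain a b where a: "a < n" "u i a \<noteq> 0" and b: "b < n" "v j b \<noteq> 0"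
      using u0 v0 ij by metis
    have "(F i * F j) $$ (a, b) = (\<Sum>k<n. (u i a * v i k) * (u j k * v j b))"
      using a b by (simp add: uv ij scalar_prod_def atLeast0LessThan)
    also have "\<dots> = (\<Sum>k<n. v i k * u j k) * (u i a * v j b)"
      by (simp add: sum_distrib_left sum_distrib_right mult_ac)
    finally have "(\<Sum>k<n. v i k * u j k) * (u i a * v j b) =
        (if i = j then u i a * v j b else 0)"
      using orth[OF ij] a b uv[OF ij(1)] by (simp split: if_splits)
    then show ?thesis
      using a b by (simp split: if_splits)
  qed
  have "V * U = 1\<^sub>m n"
    using dual by (intro eq_matI) (auto simp: U_def V_def scalar_prod_def atLeast0LessThan)
  \<comment> \<open>A left inverse of a square matrix is a right inverse; both matrices are square
    because there are exactly \<open>n\<close> idempotents of size \<open>n\<close>.\<close>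
  then have "U * V = 1\<^sub>m n"
    by (rule mat_mult_left_right_inverse[rotated 2]) (auto simp: U_def V_def)
  moreover have "(U * V) $$ (a, b) = (\<Sum>i<n. F i $$ (a, b))"
    using ab by (simp add: U_def V_def uv scalar_prod_def atLeast0LessThan)
  ultimately show ?thesis
    by simp
qed

section \<open>Complete systems of rank one idempotents\<close>

text \<open>Coefficients belong to indices rather than vectors, so the description applies to the
  \<open>A i\<close> before they are known to be distinct.\<close>

lemma (in Vector_Spaces.vector_space) span_family:
  "span (u ` {0..d::nat}) = range (\<lambda>c. \<Sum>i=0..d. scale (c i) (u i))"
proof (rule span_unique)
  show "u ` {0..d} \<subseteq> range (\<lambda>c. \<Sum>i=0..d. scale (c i) (u i))"
  proof clarify
    fix j :: nat
    assume j: "j \<in> {0..d}"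
    have "(\<Sum>i=0..d. scale (if i = j then 1 else 0) (u i)) = (\<Sum>i=0..d. if i = j then u i else 0)"
      by (intro sum.cong) auto
    then have "u j = (\<Sum>i=0..d. scale (if i = j then 1 else 0) (u i))"
      using j by simp
    then show "u j \<in> range (\<lambda>c. \<Sum>i=0..d. scale (c i) (u i))"
      by (intro range_eqI[where x = "\<lambda>i. if i = j then 1 else 0"])
  qed
  show "subspace (range (\<lambda>c. \<Sum>i=0..d. scale (c i) (u i)))"
  proof (rule subspaceI)
    show "0 \<in> range (\<lambda>c. \<Sum>i=0..d. scale (c i) (u i))"
      by (intro range_eqI[where x = "\<lambda>i. 0"]) simp
  next
    fix x y
    assume "x \<in> range (\<lambda>c. \<Sum>i=0..d. scale (c i) (u i))"
      and "y \<in> range (\<lambda>c. \<Sum>i=0..d. scale (c i) (u i))"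
    then obtain b c where "x = (\<Sum>i=0..d. scale (b i) (u i))" "y = (\<Sum>i=0..d. scale (c i) (u i))"
      by auto
    then show "x + y \<in> range (\<lambda>c. \<Sum>i=0..d. scale (c i) (u i))"
      by (intro range_eqI[where x = "\<lambda>i. b i + c i"]) (simp add: scale_left_distrib sum.distrib)
  next
    fix a x
    assume "x \<in> range (\<lambda>c. \<Sum>i=0..d. scale (c i) (u i))"
    then obtain c where "x = (\<Sum>i=0..d. scale (c i) (u i))"
      by auto
    then show "scale a x \<in> range (\<lambda>c. \<Sum>i=0..d. scale (c i) (u i))"
      by (intro range_eqI[where x = "\<lambda>i. a * c i"]) (simp add: scale_sum_right)
  qed
  show "range (\<lambda>c. \<Sum>i=0..d. scale (c i) (u i)) \<subseteq> T"
    if "u ` {0..d} \<subseteq> T" "subspace T" for T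
    using that by (auto intro!: subspace_sum subspace_scale)
qed

text \<open>Independence over indices also yields injectivity: a repetition \<open>u i = u j\<close>
  would be a relation with coefficients 1 and -1.\<close>

lemma (in Vector_Spaces.vector_space) basis_familyI:
  assumes indep: "\<And>c j. (\<Sum>i=0..d. scale (c i) (u i)) = 0 \<Longrightarrow> j \<le> d \<Longrightarrow> c j = 0"
    and span: "span (u ` {0..d}) = V"
  shows "basis_family scale d V u"
proof -
  have inj: "inj_on u {0..d}"
  proof (rule inj_onI, rule ccontr)
    fix i j
    assume ij: "i \<in> {0..d}" "j \<in> {0..d}" "u i = u j" "i \<noteq> j"
    let ?c = "\<lambda>h. (if h = i then 1 else 0) - (if h = j then 1 else 0)"
    have "(\<Sum>h=0..d. scale (?c h) (u h)) =
        (\<Sum>h=0..d. (if h = i then u h else 0) - (if h = j then u h else 0))"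
      by (intro sum.cong) (auto simp: scale_left_diff_distrib)
    also have "\<dots> = 0"
      using ij by (simp add: sum_subtractf)
    finally show False
      using indep[of ?c i] ij by simp
  qed
  have "independent (u ` {0..d})"
  proof (rule independent_if_scalars_zero)
    fix f x
    assume "(\<Sum>x\<in>u ` {0..d}. scale (f x) x) = 0" "x \<in> u ` {0..d}"
    then show "f x = 0"
      using indep[of "f \<circ> u"] by (auto simp: sum.reindex[OF inj])
  qed simp
  with inj span show ?thesis
    by (simp add: basis_family_def)
qed

text \<open>What the algebraic argument uses of rank one, stated without matrices:
  \<open>corner\<close> says that each \<open>E i\<close> compresses the algebra to a line.\<close>

locale complete_idempotents = unital_algebra scale
  for scale :: "'f::field \<Rightarrow> 'a::ring_1 \<Rightarrow> 'a" +
  fixes d :: nat and E :: "nat \<Rightarrow> 'a"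
  assumes orth: "i \<le> d \<Longrightarrow> j \<le> d \<Longrightarrow> E i * E j = (if i = j then E i else 0)"
    and nonzero: "i \<le> d \<Longrightarrow> E i \<noteq> 0"
    and complete: "(\<Sum>i=0..d. E i) = 1"
    and corner: "i \<le> d \<Longrightarrow> \<exists>c. E i * x * E i = scale c (E i)"
begin

definition comb :: "(nat \<Rightarrow> 'f) \<Rightarrow> 'a" where
  "comb c = (\<Sum>i=0..d. scale (c i) (E i))"

lemma span_E: "span (E ` {0..d}) = range comb"
  by (simp add: span_family comb_def)

lemma comb_mult_E: "j \<le> d \<Longrightarrow> comb c * E j = scale (c j) (E j)"
proof -
  assume j: "j \<le> d"
  have "comb c * E j = (\<Sum>i=0..d. if i = j then scale (c i) (E i) else 0)"
    unfolding comb_def sum_distrib_right using j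
    by (intro sum.cong) (auto simp: scale_mult_left orth)
  then show ?thesis
    using j by simp
qed

lemma E_mult_comb: "j \<le> d \<Longrightarrow> E j * comb c = scale (c j) (E j)"
proof -
  assume j: "j \<le> d"
  have "E j * comb c = (\<Sum>i=0..d. if i = j then scale (c i) (E i) else 0)"
    unfolding comb_def sum_distrib_left using j
    by (intro sum.cong) (auto simp: scale_mult_right orth)
  then show ?thesis
    using j by simp
qed

lemma comb_mult_comb: "comb b * comb c = comb (\<lambda>i. b i * c i)"
proof -
  have "comb b * comb c = (\<Sum>i=0..d. scale (b i) (E i * comb c))"
    by (simp add: comb_def[of b] sum_distrib_right scale_mult_left)
  also have "\<dots> = comb (\<lambda>i. b i * c i)"
    unfolding comb_def[of "\<lambda>i. b i * c i"] by (intro sum.cong) (auto simp: E_mult_comb)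
  finally show ?thesis .
qed

lemma one_eq_comb: "1 = comb (\<lambda>i. 1)"
  by (simp add: comb_def complete)

lemma commutative_algebra_on_span: "commutative_algebra_on scale (span (E ` {0..d}))"
  unfolding commutative_algebra_on_def
proof (intro conjI ballI)
  show "unital_algebra scale" ..
  show "1 \<in> span (E ` {0..d})"
    unfolding span_E using one_eq_comb by blast
  fix x y
  assume "x \<in> span (E ` {0..d})" "y \<in> span (E ` {0..d})"
  then show "x * y \<in> span (E ` {0..d})" "x * y = y * x"
    unfolding span_E by (auto simp: comb_mult_comb mult.commute)
qed simp

text \<open>Left multiplication by \<open>E j\<close> kills every term except the one with index
  \<open>j\<close>. It is applied to \<open>E i\<close>, to \<open>E i * Es 0 * E 0\<close> and, in
  the dual system, to \<open>Es i * E 0\<close>.\<close>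

lemma separated_family_independent:
  assumes u: "\<And>i. i \<le> d \<Longrightarrow> E i * u i = u i" "\<And>i. i \<le> d \<Longrightarrow> u i \<noteq> 0"
    and sum: "(\<Sum>i=0..d. scale (c i) (u i)) = 0" and j: "j \<le> d"
  shows "c j = 0"
proof -
  have "0 = E j * (\<Sum>i=0..d. scale (c i) (E i * u i))"
    using sum u(1) by simp
  also have "\<dots> = (\<Sum>i=0..d. if i = j then scale (c i) (E i * u i) else 0)"
    unfolding sum_distrib_left using j
    by (intro sum.cong) (auto simp: scale_mult_right orth simp flip: mult.assoc)
  also have "\<dots> = scale (c j) (u j)"
    using j u(1) by simp
  finally show ?thesis
    using u(2)[OF j] by simp
qed

lemma primitive_idempotents_span: "primitive_idempotents scale d (span (E ` {0..d})) E"
  unfolding primitive_idempotents_def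
proof (intro conjI allI impI)
  show "basis_family scale d (span (E ` {0..d})) E"
  proof (rule basis_familyI)
    show "c j = 0" if "(\<Sum>i=0..d. scale (c i) (E i)) = 0" "j \<le> d" for c j
      by (rule separated_family_independent[OF _ _ that]) (auto simp: orth nonzero)
  qed simp
qed (simp_all add: orth complete)

end

text \<open>Since \<open>e * y * f * z * e\<close> is a nonzero multiple of \<open>e\<close>, it can
  be inserted in front of \<open>x * f\<close>; the factor \<open>f * (z * e * x) * f\<close> is
  then a multiple of \<open>f\<close> and absorbs \<open>x\<close>.\<close>

lemma (in unital_algebra) corner_line:
  assumes e: "\<And>x. \<exists>c. e * x * e = scale c e" and f: "\<And>x. \<exists>c. f * x * f = scale c f"
    and nz: "e * y * f * z * e \<noteq> 0"
  shows "\<exists>c. e * x * f = scale c (e * y * f)"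
proof -
  obtain c where c: "e * (y * f * z) * e = scale c e"
    using e by blast
  obtain b where b: "f * (z * e * x) * f = scale b f"
    using f by blast
  have "c \<noteq> 0"
    using c nz by (auto simp: mult.assoc)
  have "scale c (e * x * f) = e * (y * f * z) * e * x * f"
    by (simp add: c scale_mult_left)
  also have "\<dots> = e * y * (f * (z * e * x) * f)"
    by (simp add: mult.assoc)
  also have "\<dots> = scale b (e * y * f)"
    by (simp add: b scale_mult_right)
  finally have "scale (inverse c) (scale c (e * x * f)) = scale (inverse c) (scale b (e * y * f))"
    by simp
  then show ?thesis
    using \<open>c \<noteq> 0\<close> by auto
qed

section \<open>The character system\<close>

locale idempotent_pair =
  complete_idempotents scale d E + dual: complete_idempotents scale d Es
  for scale :: "'f::field \<Rightarrow> 'a::ring_1 \<Rightarrow> 'a" and d :: nat and E Es :: "nat \<Rightarrow> 'a" +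
  fixes \<tau> :: "'a \<Rightarrow> 'a"
  assumes E0_Es_E0: "i \<le> d \<Longrightarrow> E 0 * Es i * E 0 \<noteq> 0"
    and Es0_E_Es0: "i \<le> d \<Longrightarrow> Es 0 * E i * Es 0 \<noteq> 0"
    and linear_\<tau>: "Vector_Spaces.linear scale scale \<tau>"
    and \<tau>_mult: "\<tau> (y * z) = \<tau> z * \<tau> y"
    and \<tau>_E: "i \<le> d \<Longrightarrow> \<tau> (E i) = E i"
    and \<tau>_Es: "i \<le> d \<Longrightarrow> \<tau> (Es i) = Es i"
begin

abbreviation M :: "'a set" where
  "M \<equiv> span (E ` {0..d})"

abbreviation A :: "nat \<Rightarrow> 'a" where
  "A \<equiv> system_A scale d (E, Es)"

section \<open>Nonzero corners and the bijection from \<open>M\<close> onto the left ideal of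
  \<open>E 0\<close>\<close>

lemma Es_E0_nonzero: "i \<le> d \<Longrightarrow> Es i * E 0 \<noteq> 0"
  using E0_Es_E0[of i] by (auto simp: mult.assoc)

text \<open>Provides the hypothesis of \<open>corner_line\<close> with \<open>y\<close> and
  \<open>z\<close> equal to \<open>Es 0\<close>. Multiplying by \<open>Es 0\<close> on both sides
  gives a nonzero multiple of \<open>Es 0 * E 0 * Es 0\<close>.\<close>

lemma E_Es0_E0_nonzero: "i \<le> d \<Longrightarrow> E i * Es 0 * E 0 * Es 0 * E i \<noteq> 0"
proof
  assume i: "i \<le> d" and zero: "E i * Es 0 * E 0 * Es 0 * E i = 0"
  obtain c where c: "Es 0 * E i * Es 0 = scale c (Es 0)"
    using dual.corner by blast
  then have "c \<noteq> 0"
    using Es0_E_Es0[OF i] by auto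
  have "scale c (scale c (Es 0 * E 0 * Es 0)) = (Es 0 * E i * Es 0) * E 0 * (Es 0 * E i * Es 0)"
    by (simp add: c scale_mult_left scale_mult_right)
  also have "\<dots> = Es 0 * (E i * Es 0 * E 0 * Es 0 * E i) * Es 0"
    by (simp add: mult.assoc)
  finally show False
    using zero \<open>c \<noteq> 0\<close> Es0_E_Es0[of 0] by simp
qed

text \<open>The factors 1 are the \<open>y\<close> and \<open>z\<close> of
  \<open>corner_line\<close>. Multiplying by \<open>E 0\<close> on both sides gives a nonzero
  multiple of \<open>E 0 * Es i * E 0\<close>.\<close>

lemma Es_E0_Es_nonzero: "i \<le> d \<Longrightarrow> Es i * 1 * E 0 * 1 * Es i \<noteq> 0"
proof
  assume i: "i \<le> d" and zero: "Es i * 1 * E 0 * 1 * Es i = 0"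
  obtain m where m: "E 0 * Es i * E 0 = scale m (E 0)"
    using corner by blast
  then have "m \<noteq> 0"
    using E0_Es_E0[OF i] by auto
  have "scale m (E 0 * Es i * E 0) = (E 0 * Es i * E 0) * Es i * E 0"
    by (simp add: m scale_mult_left)
  also have "\<dots> = E 0 * (Es i * 1 * E 0 * 1 * Es i) * E 0"
    by (simp add: mult.assoc)
  finally show False
    using zero \<open>m \<noteq> 0\<close> E0_Es_E0[OF i] by simp
qed

text \<open>In the coordinates of \<open>X - Y\<close> the equation is a relation among the elements
  \<open>E i * Es 0 * E 0\<close>, which are nonzero and separated by the
  \<open>E i\<close>.\<close>

lemma M_inj:
  assumes "X \<in> M" and "Y \<in> M" and eq: "X * Es 0 * E 0 = Y * Es 0 * E 0"
  shows "X = Y"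
proof -
  have "X - Y \<in> M"
    using assms by (intro span_diff)
  then obtain c where c: "X - Y = comb c"
    unfolding span_E by auto
  have "(\<Sum>i=0..d. scale (c i) (E i * Es 0 * E 0)) = (X - Y) * Es 0 * E 0"
    by (simp add: c comb_def sum_distrib_right scale_mult_left)
  also have "\<dots> = 0"
    using eq by (simp add: left_diff_distrib)
  finally have sum: "(\<Sum>i=0..d. scale (c i) (E i * Es 0 * E 0)) = 0" .
  have "c j = 0" if "j \<le> d" for j
  proof (rule separated_family_independent[OF _ _ sum that])
    show "E i * (E i * Es 0 * E 0) = E i * Es 0 * E 0" if "i \<le> d" for i
      using that by (simp add: orth flip: mult.assoc)
    show "E i * Es 0 * E 0 \<noteq> 0" if "i \<le> d" for i
      using E_Es0_E0_nonzero[OF that] by auto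
  qed
  then have "X - Y = 0"
    unfolding c comb_def by simp
  then show ?thesis
    by simp
qed

text \<open>Completeness splits \<open>y * E 0\<close> into pieces \<open>E i * y * E 0\<close>;
  each is a multiple of \<open>E i * Es 0 * E 0\<close>, and the multipliers are the coordinates of
  \<open>X\<close>.\<close>

lemma M_surj: "\<exists>X\<in>M. X * Es 0 * E 0 = y * E 0"
proof -
  have "\<exists>c. E i * y * E 0 = scale c (E i * Es 0 * E 0)" if "i \<le> d" for i
    by (rule corner_line[OF corner corner E_Es0_E0_nonzero]) (use that in auto)
  then obtain c where c: "\<And>i. i \<le> d \<Longrightarrow> E i * y * E 0 = scale (c i) (E i * Es 0 * E 0)"
    by metis
  have "comb c * Es 0 * E 0 = (\<Sum>i=0..d. scale (c i) (E i * Es 0 * E 0))"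
    by (simp add: comb_def sum_distrib_right scale_mult_left)
  also have "\<dots> = (\<Sum>i=0..d. E i * y * E 0)"
    using c by simp
  also have "\<dots> = y * E 0"
    by (simp add: complete flip: sum_distrib_right)
  finally show ?thesis
    unfolding span_E by blast
qed

text \<open>\<open>M_surj\<close> and \<open>M_inj\<close> justify the definite description;
  afterwards \<open>A i\<close> is used only through these two properties.\<close>

lemma A_props: "A i \<in> M" "A i * Es 0 * E 0 = Es i * E 0"
proof -
  have "\<exists>!X. X \<in> system_M scale d (E, Es) \<and> X * Es 0 * E 0 = Es i * E 0"
    using M_surj[of "Es i"] M_inj by auto
  from theI'[OF this] show "A i \<in> M" "A i * Es 0 * E 0 = Es i * E 0"
    by simp_all
qed

declare system_A.simps [simp del]

section \<open>The \<open>A i\<close> as a basis of \<open>M\<close>\<close>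

lemma sum_A_mult: "(\<Sum>i=0..d. scale (c i) (A i)) * Es 0 * E 0 = (\<Sum>i=0..d. scale (c i) (Es i * E 0))"
  by (simp add: sum_distrib_right scale_mult_left A_props)

lemma A_0: "A 0 = 1"
proof (rule M_inj)
  show "1 \<in> M"
    unfolding span_E using one_eq_comb by blast
qed (simp_all add: A_props)

text \<open>The \<open>Es i\<close> cut \<open>X * Es 0 * E 0\<close> into multiples of
  \<open>Es i * E 0\<close>; by \<open>M_inj\<close> the same coefficients express \<open>X\<close>
  through the \<open>A i\<close>.\<close>

lemma span_A: "span (A ` {0..d}) = M"
proof
  show "span (A ` {0..d}) \<subseteq> M"
    by (intro span_minimal) (auto simp: A_props)
  show "M \<subseteq> span (A ` {0..d})"
  proof
    fix X
    assume X: "X \<in> M"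
    have "\<exists>c. Es i * (X * Es 0) * E 0 = scale c (Es i * 1 * E 0)" if "i \<le> d" for i
      by (rule corner_line[OF dual.corner corner Es_E0_Es_nonzero]) (use that in auto)
    then obtain c where c: "\<And>i. i \<le> d \<Longrightarrow> Es i * (X * Es 0) * E 0 = scale (c i) (Es i * E 0)"
      by (metis mult.right_neutral)
    have "X * Es 0 * E 0 = (\<Sum>i=0..d. Es i * (X * Es 0) * E 0)"
      by (simp add: dual.complete flip: sum_distrib_right)
    also have "\<dots> = (\<Sum>i=0..d. scale (c i) (A i)) * Es 0 * E 0"
      using c by (simp add: sum_A_mult)
    finally have "X = (\<Sum>i=0..d. scale (c i) (A i))"
      by (rule M_inj[OF X span_sum, rotated]) (intro span_scale A_props)
    then show "X \<in> span (A ` {0..d})"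
      unfolding span_family by blast
  qed
qed

lemma basis_A: "basis_family scale d M A"
proof (rule basis_familyI)
  fix c j
  assume zero: "(\<Sum>i=0..d. scale (c i) (A i)) = 0" and j: "j \<le> d"
  then have sum: "(\<Sum>i=0..d. scale (c i) (Es i * E 0)) = 0"
    using sum_A_mult[of c] by simp
  show "c j = 0"
    by (rule dual.separated_family_independent[OF _ _ sum j])
      (auto simp: dual.orth Es_E0_nonzero simp flip: mult.assoc)
qed (rule span_A)

section \<open>The antiautomorphism and the structure constants\<close>

lemma \<tau>_M: "X \<in> M \<Longrightarrow> \<tau> X = X"
proof -
  interpret \<tau>: Vector_Spaces.linear scale scale \<tau>
    by (rule linear_\<tau>)
  assume "X \<in> M"
  then obtain c where "X = comb c"
    unfolding span_E by auto
  then show ?thesis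
    by (simp add: comb_def \<tau>.sum \<tau>.scale \<tau>_E)
qed

lemma E0_Es0_A:
  assumes "i \<le> d"
  shows "E 0 * Es 0 * A i = E 0 * Es i"
proof -
  have "\<tau> (A i * Es 0 * E 0) = \<tau> (Es i * E 0)"
    by (simp add: A_props)
  then show ?thesis
    using assms by (simp add: \<tau>_mult \<tau>_M A_props \<tau>_E \<tau>_Es mult.assoc)
qed

text \<open>The scalar exists by \<open>corner\<close> and is unique since \<open>E 0\<close> is
  nonzero. In a matrix algebra it is the trace of \<open>E 0 * Es i\<close>.\<close>

definition m :: "nat \<Rightarrow> 'f" where
  "m i = (SOME c. E 0 * Es i * E 0 = scale c (E 0))"

lemma E0_Es_E0_eq: "E 0 * Es i * E 0 = scale (m i) (E 0)"
  unfolding m_def by (rule someI_ex) (simp add: corner)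

lemma m_nonzero: "i \<le> d \<Longrightarrow> m i \<noteq> 0"
  using E0_Es_E0[of i] by (auto simp: E0_Es_E0_eq)

lemma structure_constant_0:
  assumes ij: "i \<le> d" "j \<le> d" and p: "A i * A j = (\<Sum>h=0..d. scale (p h) (A h))"
  shows "p 0 = (if i = j then m i / m 0 else 0)"
proof -
  have "E 0 * Es 0 * (A i * A j) * Es 0 * E 0 = (E 0 * Es 0 * A i) * (A j * Es 0 * E 0)"
    by (simp add: mult.assoc)
  also have "\<dots> = E 0 * (Es i * Es j) * E 0"
    unfolding E0_Es0_A[OF ij(1)] A_props(2) by (simp add: mult.assoc)
  also have "\<dots> = scale (if i = j then m i else 0) (E 0)"
    using ij by (simp add: dual.orth E0_Es_E0_eq)
  finally have 1: "E 0 * Es 0 * (A i * A j) * Es 0 * E 0 = scale (if i = j then m i else 0) (E 0)" .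
  \<comment> \<open>Second evaluation: after expansion the term of index \<open>h\<close> contains
    \<open>Es 0 * Es h\<close>, so only \<open>h = 0\<close> survives.\<close>
  have "E 0 * Es 0 * (A i * A j) * Es 0 * E 0 =
      E 0 * (Es 0 * ((\<Sum>h=0..d. scale (p h) (A h)) * Es 0 * E 0))"
    unfolding p by (simp add: mult.assoc)
  also have "\<dots> = E 0 * (\<Sum>h=0..d. if h = 0 then scale (p h) (Es 0 * E 0) else 0)"
    unfolding sum_A_mult sum_distrib_left
    by (intro sum.cong refl arg_cong2[where f = "(*)"])
      (auto simp: scale_mult_right dual.orth simp flip: mult.assoc)
  also have "\<dots> = scale (p 0 * m 0) (E 0)"
    by (simp add: scale_mult_right E0_Es_E0_eq flip: mult.assoc)
  finally have "p 0 * m 0 = (if i = j then m i else 0)"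
    using 1 nonzero[of 0] by simp
  then show ?thesis
    using m_nonzero[of 0] by (simp add: field_simps split: if_splits)
qed

section \<open>The homomorphism to the field and the character system\<close>

text \<open>As an eigenvalue on \<open>E 0\<close> the scalar satisfies the homomorphism laws on
  \<open>M\<close> at once, by uniqueness (\<open>\<phi>_eqI\<close>).\<close>

definition \<phi> :: "'a \<Rightarrow> 'f" where
  "\<phi> X = (SOME c. X * E 0 = scale c (E 0))"

lemma \<phi>_eqI: "X * E 0 = scale c (E 0) \<Longrightarrow> \<phi> X = c"
  unfolding \<phi>_def using nonzero[of 0] by (intro some_equality) auto

lemma \<phi>_eq: "X \<in> M \<Longrightarrow> X * E 0 = scale (\<phi> X) (E 0)"
  unfolding span_E using comb_mult_E[of 0] by (auto simp: \<phi>_eqI)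

lemma \<phi>_hom: "algebra_hom_to_field scale M \<phi>"
  unfolding algebra_hom_to_field_def
proof (intro conjI ballI allI)
  fix X Y
  assume X: "X \<in> M" and Y: "Y \<in> M"
  show "\<phi> (X + Y) = \<phi> X + \<phi> Y"
    by (rule \<phi>_eqI) (simp add: distrib_right scale_left_distrib \<phi>_eq X Y)
  show "\<phi> (X * Y) = \<phi> X * \<phi> Y"
    by (rule \<phi>_eqI) (simp add: mult.assoc scale_mult_right \<phi>_eq X Y mult.commute)
next
  fix c X
  assume "X \<in> M"
  then show "\<phi> (scale c X) = c * \<phi> X"
    by (intro \<phi>_eqI) (simp add: scale_mult_left \<phi>_eq)
qed (simp add: \<phi>_eqI)

lemma \<phi>_A: "\<phi> (A i) = m i / m 0"
proof -
  obtain c where c: "A i = comb c"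
    using A_props(1)[of i] unfolding span_E by auto
  have \<phi>: "\<phi> (A i) = c 0"
    by (rule \<phi>_eqI) (simp add: c comb_mult_E)
  \<comment> \<open>The right-hand side is evaluated by the defining equation of \<open>A i\<close>
    and again through its coordinate \<open>c 0\<close> at \<open>E 0\<close>.\<close>
  have "scale (m i) (E 0) = E 0 * (A i * Es 0 * E 0)"
    by (simp add: A_props E0_Es_E0_eq flip: mult.assoc)
  also have "\<dots> = (E 0 * comb c) * Es 0 * E 0"
    by (simp add: c mult.assoc)
  also have "\<dots> = scale (c 0 * m 0) (E 0)"
    by (simp add: E_mult_comb scale_mult_left E0_Es_E0_eq)
  finally show ?thesis
    using nonzero[of 0] m_nonzero[of 0] by (simp add: \<phi>)
qed

lemma character_algebra_with_A: "character_algebra_with scale d M A \<phi>"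
proof -
  have "\<exists>p. A i * A j = (\<Sum>h=0..d. scale (p h) (A h))" for i j
  proof -
    have "A i * A j \<in> M"
      using commutative_algebra_on_span A_props(1) by (simp add: commutative_algebra_on_def)
    then have "A i * A j \<in> span (A ` {0..d})"
      by (simp only: span_A)
    then show ?thesis
      unfolding span_family by blast
  qed
  then have "\<exists>p. \<forall>i j. A i * A j = (\<Sum>h=0..d. scale (p i j h) (A h))"
    by (intro choice allI)
  then obtain p where p: "\<And>i j. A i * A j = (\<Sum>h=0..d. scale (p i j h) (A h))"
    by blast
  have p0: "p i j 0 = (if i = j then m i / m 0 else 0)" if "i \<le> d" "j \<le> d" for i j
    by (rule structure_constant_0[OF that p])
  \<comment> \<open>The local \<open>p\<close> has its upper index last, so the witness moves it to
    the front; the scalars k are \<open>m i / m 0\<close>, matching \<open>\<phi>_A\<close>.\<close>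
  show ?thesis
    unfolding character_algebra_with_def
    using commutative_algebra_on_span A_0 basis_A p p0 m_nonzero \<phi>_hom \<phi>_A
    by (intro conjI exI[of _ "\<lambda>h i j. p i j h"] exI[of _ "\<lambda>i. m i / m 0"]) simp_all
qed

lemma character_system_A: "character_system scale d (M, A, E)"
proof -
  have "\<phi> (E 0) = 1"
    by (rule \<phi>_eqI) (simp add: orth)
  then have "trivial_idempotent scale d M A (E 0)"
    unfolding trivial_idempotent_def using character_algebra_with_A by fastforce
  then show ?thesis
    using character_algebra_with_A primitive_idempotents_span
    by (auto simp: semisimple_character_algebra_def character_algebra_def)
qed

end

section \<open>Passage from the matrix algebra to complete idempotents\<close>

text \<open>Each property is checked on the matrix images; injectivity of the isomorphism carries
  the corner and sum identities back.\<close>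

lemma complete_idempotents_of_rank_one:
  fixes scale :: "'f::field \<Rightarrow> 'a::ring_1 \<Rightarrow> 'a"
  assumes iso: "isomorphic_to_matrix_algebra scale (d + 1)"
    and E: "orthogonal_rank1_idempotents scale d E"
  shows "complete_idempotents scale d E"
proof -
  define n where "n = d + 1"
  \<comment> \<open>This must be the very choice made in \<open>algebra_rank\<close>, so that the
    rank assumption speaks about the matrices \<open>\<phi> (E i)\<close>.\<close>
  define \<phi> where "\<phi> = (SOME \<phi>. matrix_algebra_iso scale n \<phi>)"
  have "\<exists>\<phi>. matrix_algebra_iso scale n \<phi>"
    using iso by (simp add: isomorphic_to_matrix_algebra_def n_def)
  then have "matrix_algebra_iso scale n \<phi>"
    unfolding \<phi>_def by (rule someI_ex)
  then have bij: "bij_betw \<phi> UNIV (carrier_mat n n)"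
    and add: "\<And>x y. \<phi> (x + y) = \<phi> x + \<phi> y"
    and smult: "\<And>c x. \<phi> (scale c x) = c \<cdot>\<^sub>m \<phi> x"
    and mult: "\<And>x y. \<phi> (x * y) = \<phi> x * \<phi> y"
    and one: "\<phi> 1 = 1\<^sub>m n"
    by (auto simp: matrix_algebra_iso_def)
  have carrier: "\<phi> x \<in> carrier_mat n n" for x
    using bij by (auto simp: bij_betw_def)
  have inj: "\<phi> x = \<phi> y \<Longrightarrow> x = y" for x y
    using bij by (auto simp: bij_betw_def inj_def)
  interpret unital_algebra scale
    using iso by (simp add: isomorphic_to_matrix_algebra_def)
  have zero: "\<phi> 0 = 0\<^sub>m n n"
  proof -
    have "0 \<cdot>\<^sub>m \<phi> 0 = 0\<^sub>m n n"
      using carrier[of 0] by (intro eq_matI) auto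
    then show ?thesis
      using smult[of 0 0] by simp
  qed
  have rank: "vec_space.rank n (\<phi> (E i)) = 1" if "i < n" for i
    using E that by (auto simp: orthogonal_rank1_idempotents_def algebra_rank_def \<phi>_def n_def)
  have orth: "E i * E j = (if i = j then E i else 0)" if "i < n" "j < n" for i j
    using E that by (auto simp: orthogonal_rank1_idempotents_def n_def)
  \<comment> \<open>Matrices of all sizes share one type, with a different zero for each size; hence
    the sum is formed entry by entry.\<close>
  have sum: "\<phi> (\<Sum>i\<in>S. E i) $$ (a, b) = (\<Sum>i\<in>S. \<phi> (E i) $$ (a, b))"
    if "a < n" "b < n" "finite S" for S a b
    using that(3)
  proof (induction S rule: finite_induct)
    case (insert i S)
    then show ?case
      using that(1,2) carrier[of "\<Sum>i\<in>S. E i"] by (simp add: add)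
  qed (simp add: zero that)
  show ?thesis
  proof
    fix i j
    assume "i \<le> d" "j \<le> d"
    then show "E i * E j = (if i = j then E i else 0)"
      using orth by (simp add: n_def)
  next
    fix i
    assume "i \<le> d"
    then have i: "i < n"
      by (simp add: n_def)
    obtain u v where uv: "\<phi> (E i) = mat n n (\<lambda>(k, l). u k * v l)"
      and "\<exists>k<n. u k \<noteq> 0" "\<exists>l<n. v l \<noteq> 0"
      using vec_space.rank_one_outer_product[OF carrier rank[OF i]] by metis
    then obtain k l where "k < n" "l < n" "\<phi> (E i) $$ (k, l) \<noteq> 0"
      by auto
    then show "E i \<noteq> 0"
      using zero by auto
    fix x
    obtain c where "\<phi> (E i) * \<phi> x * \<phi> (E i) = c \<cdot>\<^sub>m \<phi> (E i)"
      using rank_one_corner[OF carrier rank[OF i] carrier] by blast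
    then show "\<exists>c. E i * x * E i = scale c (E i)"
      by (intro exI[of _ c] inj) (simp add: mult smult)
  next
    have "\<phi> (\<Sum>i<n. E i) = 1\<^sub>m n"
    proof (intro eq_matI)
      fix a b
      assume "a < dim_row (1\<^sub>m n :: 'f mat)" "b < dim_col (1\<^sub>m n :: 'f mat)"
      then have ab: "a < n" "b < n"
        by auto
      have "(\<Sum>i<n. \<phi> (E i) $$ (a, b)) = 1\<^sub>m n $$ (a, b)"
        by (rule sum_orthogonal_rank_one_idempotents)
          (auto simp: carrier rank orth ab zero simp flip: mult)
      then show "\<phi> (\<Sum>i<n. E i) $$ (a, b) = 1\<^sub>m n $$ (a, b)"
        using sum ab by simp
    qed (use carrier[of "\<Sum>i<n. E i"] in auto)
    then have "(\<Sum>i<n. E i) = 1"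
      using inj one by simp
    then show "(\<Sum>i=0..d. E i) = 1"
      by (simp add: n_def atLeast0AtMost lessThan_Suc_atMost)
  qed
qed

theorem proposition11p1:
  fixes scale :: "'f::field \<Rightarrow> 'a::ring_1 \<Rightarrow> 'a"
    and d :: nat
    and E Es :: "nat \<Rightarrow> 'a"
  assumes "symmetric_idempotent_system scale d (E, Es)"
  shows "character_system scale d (system_Psi scale d (E, Es)) \<and>
         eigenmatrix scale d (system_Psi scale d (E, Es)) = first_eigenmatrix scale d (E, Es)"
proof -
  obtain \<tau> where \<tau>: "antiautomorphism scale \<tau>" "\<forall>i\<le>d. \<tau> (E i) = E i \<and> \<tau> (Es i) = Es i"
    using assms by auto
  have "complete_idempotents scale d E" "complete_idempotents scale d Es"
    using assms by (auto intro!: complete_idempotents_of_rank_one)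
  then interpret idempotent_pair scale d E Es \<tau>
    using assms \<tau>
    by (auto simp: idempotent_pair_def idempotent_pair_axioms_def antiautomorphism_def)
  \<comment> \<open>Both eigenmatrices unfold to the same transition matrix from \<open>E\<close> to
    \<open>A\<close>, so the first conjunct carries the content.\<close>
  show ?thesis
    using character_system_A by simp
qed

end
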